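(* For each finite graph $\mathcal{G}=(V,E)$ and each set $\mathsf{A}\subseteq V$, the game $\mathsf{GCDS}(\mathcal{G},\mathsf{A})$ is determined, i.e. one of the two players ONE and TWO has a winning strategy.
   Context: **The graph transformation gcds.** Let $\mathcal{G}=(V,E)$ be a graph and $\{x,y\}\in E$. The master list of $\{x,y\}$ has two columns: the first consists of all neighbors of $x$ in $\mathcal{G}$ except $y$, the second of all neighbors of $y$ in $\mathcal{G}$ except $x$. The graph $\mathbf{gcds}(\mathcal{G},\{x,y\})=(V,E')$ is defined as follows. Both $x$ and $y$ are isolated in it. For $p\ne q$ in $V\setminus\{x,y\}$: (a) if $p$ or $q$ is not in the master list, then $\{p,q\}\in E'$ iff $\{p,q\}\in E$; (b) if both are in the master list, then: (b.1) if no column contains both $p$ and $q$, then $\{p,q\}\in E'$ iff $\{p,q\}\notin E$; (b.2) if some column contains both and the total number of occurrences of $p$ and $q$ in the master list (both columns together) is even, then $\{p,q\}\in E'$ iff $\{p,q\}\in E$; (b.3) if some column contains both and that total number is odd, then $\{p,q\}\in E'$ iff $\{p,q\}\notin E$. **The modification $\mathbf{gcds}_2$.** For a finite graph $\mathcal{G}=(V,E)$ and $\{a,b\}\in E$, compute $(V,E')=\mathbf{gcds}(\mathcal{G},\{a,b\})$; then delete $a$ and $b$, and also delete every vertex $v$ in the master list of $\{a,b\}$ that is isolated in $(V,E')$, unless $v$ is the only vertex in the master list. With $V'$ the set of remaining vertices, $\mathbf{gcds}_2(\mathcal{G},\{a,b\})=(V',E')$. **The game.** For a finite graph $\mathcal{G}=(V,E)$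 and $\mathsf{A}\subseteq V$, the game $\mathsf{GCDS}(\mathcal{G},\mathsf{A})$ starts with current graph $\mathcal{G}$. Players ONE and TWO alternate, ONE moving first; a move consists of choosing an edge $\{a,b\}$ of the current graph $\mathcal{C}$ and replacing $\mathcal{C}$ by $\mathbf{gcds}_2(\mathcal{C},\{a,b\})$. The game ends when the current graph has no edges. If the vertex set of the final graph is nonempty and is a subset of $\mathsf{A}$, then ONE wins; otherwise TWO wins. *)

theory Defs
  imports Main
begin

section \<open>Finite simple graphs\<close>

type_synonym 'a graph = "'a set \<times> 'a set set"

abbreviation verts :: "'a graph \<Rightarrow> 'a set" where "verts \<equiv> fst"
abbreviation edges :: "'a graph \<Rightarrow> 'a set set" where "edges \<equiv> snd"

definition finite_graph :: "'a graph \<Rightarrow> bool" where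
  "finite_graph G \<longleftrightarrow>
     finite (verts G) \<and>
     edges G \<subseteq> {{p, q} |p q. p \<in> verts G \<and> q \<in> verts G \<and> p \<noteq> q}"

definition neighbors :: "'a graph \<Rightarrow> 'a \<Rightarrow> 'a set" where
  "neighbors G u = {v. {u, v} \<in> edges G}"

definition isolated :: "'a graph \<Rightarrow> 'a \<Rightarrow> bool" where
  "isolated G v \<longleftrightarrow> v \<in> verts G \<and> (\<forall>e \<in> edges G. v \<notin> e)"


section \<open>The transformations gcds and gcds2\<close>

text \<open>
  The edge \<open>e = {x, y}\<close> is passed as an unordered pair, and the two columns of its master
  list are indexed by the endpoints of \<open>e\<close>. The column of \<open>x\<close> consists of the neighbors of
  \<open>x\<close> except \<open>y\<close>; removing all of \<open>e\<close> amounts to the same, since \<open>x\<close> is not a neighbor of itself.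
\<close>

definition column :: "'a graph \<Rightarrow> 'a set \<Rightarrow> 'a \<Rightarrow> 'a set" where
  "column G e u = neighbors G u - e"

definition master_list :: "'a graph \<Rightarrow> 'a set \<Rightarrow> 'a set" where
  "master_list G e = (\<Union>u \<in> e. column G e u)"

definition share_column :: "'a graph \<Rightarrow> 'a set \<Rightarrow> 'a \<Rightarrow> 'a \<Rightarrow> bool" where
  "share_column G e p q \<longleftrightarrow> (\<exists>u \<in> e. p \<in> column G e u \<and> q \<in> column G e u)"

definition occurrences :: "'a graph \<Rightarrow> 'a set \<Rightarrow> 'a \<Rightarrow> nat" where
  "occurrences G e p = card {u \<in> e. p \<in> column G e u}"

definition gcds_adj :: "'a graph \<Rightarrow> 'a set \<Rightarrow> 'a \<Rightarrow> 'a \<Rightarrow> bool" where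
  "gcds_adj G e p q \<longleftrightarrow>
     (if p \<notin> master_list G e \<or> q \<notin> master_list G e then {p, q} \<in> edges G
      else if \<not> share_column G e p q then {p, q} \<notin> edges G
      else if even (occurrences G e p + occurrences G e q) then {p, q} \<in> edges G
      else {p, q} \<notin> edges G)"

definition gcds :: "'a graph \<Rightarrow> 'a set \<Rightarrow> 'a graph" where
  "gcds G e =
     (verts G,
      {{p, q} |p q. p \<in> verts G - e \<and> q \<in> verts G - e \<and> p \<noteq> q \<and> gcds_adj G e p q})"

definition gcds2 :: "'a graph \<Rightarrow> 'a set \<Rightarrow> 'a graph" where
  "gcds2 G e =
     (verts G - e -
        {v \<in> master_list G e. isolated (gcds G e) v \<and> master_list G e \<noteq> {v}},
      edges (gcds G e))"


section \<open>The game\<close>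

datatype player = ONE | TWO

text \<open>A history is the list of edges chosen so far, in chronological order.\<close>

type_synonym 'a history = "'a set list"

definition current :: "'a graph \<Rightarrow> 'a history \<Rightarrow> 'a graph" where
  "current G h = foldl gcds2 G h"

definition legal :: "'a graph \<Rightarrow> 'a history \<Rightarrow> bool" where
  "legal G h \<longleftrightarrow> (\<forall>i < length h. h ! i \<in> edges (current G (take i h)))"

definition complete_play :: "'a graph \<Rightarrow> 'a history \<Rightarrow> bool" where
  "complete_play G h \<longleftrightarrow> legal G h \<and> edges (current G h) = {}"

definition to_move :: "'a history \<Rightarrow> player" where
  "to_move h = (if even (length h) then ONE else TWO)"

definition winner :: "'a graph \<Rightarrow> 'a set \<Rightarrow> 'a history \<Rightarrow> player" where
  "winner G A h =
     (if verts (current G h) \<noteq> {} \<and> verts (current G h) \<subseteq> A then ONE else TWO)"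

type_synonym 'a strategy = "'a history \<Rightarrow> 'a set"

definition is_strategy :: "'a graph \<Rightarrow> player \<Rightarrow> 'a strategy \<Rightarrow> bool" where
  "is_strategy G P \<sigma> \<longleftrightarrow>
     (\<forall>h. legal G h \<and> edges (current G h) \<noteq> {} \<and> to_move h = P
        \<longrightarrow> \<sigma> h \<in> edges (current G h))"

definition follows :: "player \<Rightarrow> 'a strategy \<Rightarrow> 'a history \<Rightarrow> bool" where
  "follows P \<sigma> h \<longleftrightarrow>
     (\<forall>i < length h. to_move (take i h) = P \<longrightarrow> h ! i = \<sigma> (take i h))"

text \<open>
  It suffices to consider finite plays: by \<open>legal_length\<close> below, no play on a finite graph
  is infinite.
\<close>

definition winning_strategy :: "'a graph \<Rightarrow> 'a set \<Rightarrow> player \<Rightarrow> 'a strategy \<Rightarrow> bool" where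
  "winning_strategy G A P \<sigma> \<longleftrightarrow>
     is_strategy G P \<sigma> \<and>
     (\<forall>h. complete_play G h \<and> follows P \<sigma> h \<longrightarrow> winner G A h = P)"

lemma finite_graph_gcds2:
  assumes "finite_graph G"
  shows "finite_graph (gcds2 G e)"
proof -
  have "f \<in> {{p, q} |p q. p \<in> verts (gcds2 G e) \<and> q \<in> verts (gcds2 G e) \<and> p \<noteq> q}"
    if f: "f \<in> edges (gcds2 G e)" for f
  proof -
    obtain p q where pq: "f = {p, q}" "p \<in> verts G - e" "q \<in> verts G - e" "p \<noteq> q"
      using f unfolding gcds2_def gcds_def by auto
    have "f \<in> edges (gcds G e)"
      using f by (simp add: gcds2_def)
    then have "\<not> isolated (gcds G e) p" "\<not> isolated (gcds G e) q"
      using pq(1) by (auto simp: isolated_def)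
    then have "p \<in> verts (gcds2 G e)" "q \<in> verts (gcds2 G e)"
      using pq by (auto simp: gcds2_def)
    then show ?thesis
      using pq by blast
  qed
  moreover have "finite (verts (gcds2 G e))"
    using assms by (simp add: finite_graph_def gcds2_def)
  ultimately show ?thesis
    unfolding finite_graph_def by blast
qed

lemma card_verts_gcds2:
  assumes "finite_graph G" "e \<in> edges G"
  shows "card (verts (gcds2 G e)) + 2 \<le> card (verts G)"
proof -
  obtain p q where e: "e = {p, q}" "p \<in> verts G" "q \<in> verts G" "p \<noteq> q"
    using assms unfolding finite_graph_def by blast
  have fin: "finite (verts G)"
    using assms by (simp add: finite_graph_def)
  have "card (verts (gcds2 G e)) \<le> card (verts G - e)"
    using fin by (intro card_mono) (auto simp: gcds2_def)
  also have "\<dots> = card (verts G) - 2"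
    using e by (subst card_Diff_subset) auto
  finally have "card (verts (gcds2 G e)) \<le> card (verts G) - 2" .
  moreover have "2 \<le> card (verts G)"
    using card_mono[OF fin, of "{p, q}"] e by auto
  ultimately show ?thesis
    by linarith
qed

lemma legal_length:
  assumes "finite_graph G" "legal G h"
  shows "2 * length h \<le> card (verts G)"
  using assms
proof (induction h arbitrary: G)
  case Nil
  then show ?case by simp
next
  case (Cons e h)
  have e: "e \<in> edges G"
    using Cons.prems(2) by (auto simp: legal_def current_def dest: spec[of _ 0])
  have "legal (gcds2 G e) h"
    unfolding legal_def
  proof (intro allI impI)
    fix i assume "i < length h"
    then have "(e # h) ! Suc i \<in> edges (current G (take (Suc i) (e # h)))"
      using Cons.prems(2) unfolding legal_def by (metis Suc_less_eq length_Cons)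
    then show "h ! i \<in> edges (current (gcds2 G e) (take i h))"
      by (simp add: current_def)
  qed
  then have "2 * length h \<le> card (verts (gcds2 G e))"
    using Cons.IH finite_graph_gcds2 Cons.prems(1) by blast
  then show ?case
    using card_verts_gcds2[OF Cons.prems(1) e] by simp
qed

end

theory Submission
  imports Defs
begin

text \<open>
  This is Zermelo's argument. Call a history winning for ONE if it lies in the least set that
  contains the complete plays won by ONE and is closed under one-step forcing by ONE. If the
  empty history is winning, ONE can keep the play inside this set; otherwise TWO can keep it
  inside the complement.
\<close>

lemma legal_Nil [simp]: "legal G []"
  by (simp add: legal_def)

lemma legal_snoc [simp]:
  "legal G (h @ [e]) \<longleftrightarrow> legal G h \<and> e \<in> edges (current G h)"
  by (auto simp: legal_def nth_append less_Suc_eq)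

lemma follows_snoc [simp]:
  "follows P \<sigma> (h @ [e]) \<longleftrightarrow> follows P \<sigma> h \<and> (to_move h = P \<longrightarrow> e = \<sigma> h)"
  by (auto simp: follows_def nth_append less_Suc_eq)

text \<open>Choosing at each history an edge that preserves \<open>Q\<close> gives a strategy whose
  plays never leave \<open>Q\<close>. Both players are served by this lemma, with complementary
  invariants.\<close>

lemma winning_strategy_if_invariant:
  assumes init: "Q []"
    and own: "\<And>h. \<lbrakk>legal G h; Q h; edges (current G h) \<noteq> {}; to_move h = P\<rbrakk>
                \<Longrightarrow> \<exists>e \<in> edges (current G h). Q (h @ [e])"
    and opponent: "\<And>h e. \<lbrakk>legal G h; Q h; e \<in> edges (current G h); to_move h \<noteq> P\<rbrakk>
                \<Longrightarrow> Q (h @ [e])"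
    and final: "\<And>h. \<lbrakk>complete_play G h; Q h\<rbrakk> \<Longrightarrow> winner G A h = P"
  shows "\<exists>\<sigma>. winning_strategy G A P \<sigma>"
proof -
  \<comment> \<open>A strategy must also answer with an edge at histories outside the invariant.\<close>
  have "\<exists>e. edges (current G h) \<noteq> {} \<longrightarrow> e \<in> edges (current G h) \<and>
          (legal G h \<and> Q h \<and> to_move h = P \<longrightarrow> Q (h @ [e]))" for h
    using own[of h] by blast
  then obtain \<sigma> where \<sigma>: "edges (current G h) \<noteq> {} \<Longrightarrow> \<sigma> h \<in> edges (current G h) \<and>
          (legal G h \<and> Q h \<and> to_move h = P \<longrightarrow> Q (h @ [\<sigma> h]))" for h
    by metis
  \<comment> \<open>The last move is either the answer of \<open>\<sigma>\<close>, which keeps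
    \<open>Q\<close> by choice, or a move of the other player, covered by
    \<open>opponent\<close>.\<close>
  have "Q h" if "legal G h" "follows P \<sigma> h" for h
    using that
  proof (induction h rule: rev_induct)
    case Nil
    show ?case by (rule init)
  next
    case (snoc e h)
    then have "Q h" "legal G h" "e \<in> edges (current G h)" "to_move h = P \<longrightarrow> e = \<sigma> h"
      by auto
    then show ?case
      using \<sigma>[of h] opponent[of h e] by blast
  qed
  then have "winning_strategy G A P \<sigma>"
    using \<sigma> final by (auto simp: winning_strategy_def is_strategy_def complete_play_def)
  then show ?thesis
    by blast
qed

text \<open>The nonemptiness premise of \<open>TWO_moves\<close> matters: without it, every edgeless
  history with TWO to move would vacuously count as won by ONE.\<close>

inductive ONE_wins :: "'a graph \<Rightarrow> 'a set \<Rightarrow> 'a history \<Rightarrow> bool" for G A where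
  final: "edges (current G h) = {} \<Longrightarrow> winner G A h = ONE \<Longrightarrow> ONE_wins G A h"
| ONE_moves: "to_move h = ONE \<Longrightarrow> e \<in> edges (current G h) \<Longrightarrow> ONE_wins G A (h @ [e])
    \<Longrightarrow> ONE_wins G A h"
| TWO_moves: "to_move h = TWO \<Longrightarrow> edges (current G h) \<noteq> {}
    \<Longrightarrow> (\<And>e. e \<in> edges (current G h) \<Longrightarrow> ONE_wins G A (h @ [e])) \<Longrightarrow> ONE_wins G A h"

lemma player_neq_iff: "P \<noteq> TWO \<longleftrightarrow> P = ONE"
  by (cases P) simp_all

theorem theorem3:
  fixes G :: "'a graph" and A :: "'a set"
  assumes "finite_graph G" and "A \<subseteq> verts G"
  shows "(\<exists>\<sigma>. winning_strategy G A ONE \<sigma>) \<or> (\<exists>\<sigma>. winning_strategy G A TWO \<sigma>)"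
proof (cases "ONE_wins G A []")
  case True
  then have "\<exists>\<sigma>. winning_strategy G A ONE \<sigma>"
  proof (rule winning_strategy_if_invariant)
    fix h assume "ONE_wins G A h" "edges (current G h) \<noteq> {}" "to_move h = ONE"
    \<comment> \<open>The existing edge rules out \<open>final\<close> and the turn rules out
      \<open>TWO_moves\<close>; the edge supplied by \<open>ONE_moves\<close> is the
      witness.\<close>
    then show "\<exists>e \<in> edges (current G h). ONE_wins G A (h @ [e])"
      by (cases rule: ONE_wins.cases) auto
  next
    fix h e assume "ONE_wins G A h" "e \<in> edges (current G h)" "to_move h \<noteq> ONE"
    then show "ONE_wins G A (h @ [e])"
      by (cases rule: ONE_wins.cases) auto
  next
    fix h assume "complete_play G h" "ONE_wins G A h"
    \<comment> \<open>Both move rules require an edge, so at a complete play only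
      \<open>final\<close> remains.\<close>
    then show "winner G A h = ONE"
      by (auto simp: complete_play_def elim: ONE_wins.cases)
  qed
  then show ?thesis ..
next
  case False
  then have "\<exists>\<sigma>. winning_strategy G A TWO \<sigma>"
  \<comment> \<open>The chained fact sets the invariant to the complement of
    \<open>ONE_wins\<close>; the three obligations are contrapositives of its introduction
    rules.\<close>
  proof (rule winning_strategy_if_invariant)
    fix h assume "\<not> ONE_wins G A h" "edges (current G h) \<noteq> {}" "to_move h = TWO"
    then show "\<exists>e \<in> edges (current G h). \<not> ONE_wins G A (h @ [e])"
      using ONE_wins.TWO_moves by blast
  next
    fix h e assume "\<not> ONE_wins G A h" "e \<in> edges (current G h)" "to_move h \<noteq> TWO"
    then show "\<not> ONE_wins G A (h @ [e])"
      by (metis ONE_wins.ONE_moves player_neq_iff)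
  next
    fix h assume "complete_play G h" "\<not> ONE_wins G A h"
    then show "winner G A h = TWO"
      by (metis ONE_wins.final complete_play_def player_neq_iff)
  qed
  then show ?thesis ..
qed

end
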